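(* Let $\mathcal{LC}$ be the local-causal polytope of conditional distributions $p(a_1a_2bc\mid x_1x_2yz)$ with all variables binary (defined in the context). If $p\in\mathcal{LC}$ then $$p(b=0, a_2=x_1 \mid y=0) + p(b=1, a_1=x_2 \mid y=0) + p(b\oplus c = yz\mid x_1=x_2=0) \leq \frac74,$$ and this bound is attained by some $p\in\mathcal{LC}$.
   Context: All settings $x_1,x_2,y,z$ and outcomes $a_1,a_2,b,c$ take values in $\{0,1\}$; $\oplus$ is addition mod 2. Let $\mathcal P$ be the set of all conditional probability distributions $p(a_1a_2bc\mid x_1x_2yz)$. For a set $S$ of outcome variables and a set $T$ of setting variables, write $S\perp_p T$ to mean that the marginal $\sum_{\text{outcomes not in }S} p(a_1a_2bc\mid x_1x_2yz)$ is, for every value of the outcomes in $S$ and of the settings not in $T$, independent of the values of the settings in $T$. Define $\mathcal{NS}=\{p\in\mathcal P: \{a_1,a_2,c\}\perp_p \{y\}\text{ and } \{b\}\perp_p\{x_1,x_2,z\}\}$; $\mathcal{LC}_1=\{p\in\mathcal{NS}: \{a_1,b\}\perp_p\{x_2\}\text{ and }\{a_1,a_2,b\}\perp_p\{z\}\}$; $\mathcal{LC}_2=\{p\in\mathcal{NS}: \{a_2,b\}\perp_p\{x_1\}\text{ and }\{a_1,a_2,b\}\perp_p\{z\}\}$; $\mathcal{LC}=\{\mu p_1+(1-\mu)p_2:\mu\in[0,1],\,p_1\in\mathcal{LC}_1,\,p_2\in\mathcal{LC}_2\}$. Shorthand (settings treated as uniformly and independently distributed): $p(b=0,a_2=x_1\mid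 y=0)=\frac18\sum_{x_1,x_2,z}p(b=0,a_2=x_1\mid x_1x_2,y=0,z)$; $p(b=1,a_1=x_2\mid y=0)=\frac18\sum_{x_1,x_2,z}p(b=1,a_1=x_2\mid x_1x_2,y=0,z)$; $p(b\oplus c=yz\mid x_1=x_2=0)=\frac14\sum_{y,z}p(b\oplus c=yz\mid x_1=x_2=0,y,z)$, where each event probability is the sum of $p(a_1a_2bc\mid x_1x_2yz)$ over outcomes satisfying the event. *)

theory Defs
  imports Complex_Main
begin

text \<open>Binary values 0/1 are encoded as False/True; xor is (\<noteq>) and product is (\<and>).
  A behaviour p maps (a1 a2 b c x1 x2 y z) to p(a1 a2 b c | x1 x2 y z).\<close>

type_synonym behav = "bool \<Rightarrow> bool \<Rightarrow> bool \<Rightarrow> bool \<Rightarrow> bool \<Rightarrow> bool \<Rightarrow> bool \<Rightarrow> bool \<Rightarrow> real"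

definition cond_dist :: "behav \<Rightarrow> bool" where
  "cond_dist p \<longleftrightarrow>
     (\<forall>a1 a2 b c x1 x2 y z. p a1 a2 b c x1 x2 y z \<ge> 0) \<and>
     (\<forall>x1 x2 y z. (\<Sum>a1\<in>UNIV. \<Sum>a2\<in>UNIV. \<Sum>b\<in>UNIV. \<Sum>c\<in>UNIV. p a1 a2 b c x1 x2 y z) = 1)"

definition NS :: "behav set" where
  "NS = {p. cond_dist p \<and>
     \<comment> \<open>{a1,a2,c} independent of {y}\<close>
     (\<forall>a1 a2 c x1 x2 y y' z.
        (\<Sum>b\<in>UNIV. p a1 a2 b c x1 x2 y z) = (\<Sum>b\<in>UNIV. p a1 a2 b c x1 x2 y' z)) \<and>
     \<comment> \<open>{b} independent of {x1,x2,z}\<close>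
     (\<forall>b y x1 x2 z x1' x2' z'.
        (\<Sum>a1\<in>UNIV. \<Sum>a2\<in>UNIV. \<Sum>c\<in>UNIV. p a1 a2 b c x1 x2 y z) =
        (\<Sum>a1\<in>UNIV. \<Sum>a2\<in>UNIV. \<Sum>c\<in>UNIV. p a1 a2 b c x1' x2' y z'))}"

definition ind_a1a2b_z :: "behav \<Rightarrow> bool" where
  "ind_a1a2b_z p \<longleftrightarrow> (\<forall>a1 a2 b x1 x2 y z z'.
      (\<Sum>c\<in>UNIV. p a1 a2 b c x1 x2 y z) = (\<Sum>c\<in>UNIV. p a1 a2 b c x1 x2 y z'))"

definition LC1 :: "behav set" where
  "LC1 = {p. p \<in> NS \<and>
     (\<forall>a1 b x1 x2 x2' y z.
        (\<Sum>a2\<in>UNIV. \<Sum>c\<in>UNIV. p a1 a2 b c x1 x2 y z) =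
        (\<Sum>a2\<in>UNIV. \<Sum>c\<in>UNIV. p a1 a2 b c x1 x2' y z)) \<and>
     ind_a1a2b_z p}"

definition LC2 :: "behav set" where
  "LC2 = {p. p \<in> NS \<and>
     (\<forall>a2 b x1 x1' x2 y z.
        (\<Sum>a1\<in>UNIV. \<Sum>c\<in>UNIV. p a1 a2 b c x1 x2 y z) =
        (\<Sum>a1\<in>UNIV. \<Sum>c\<in>UNIV. p a1 a2 b c x1' x2 y z)) \<and>
     ind_a1a2b_z p}"

definition LC :: "behav set" where
  "LC = {(\<lambda>a1 a2 b c x1 x2 y z. \<mu> * p1 a1 a2 b c x1 x2 y z + (1 - \<mu>) * p2 a1 a2 b c x1 x2 y z)
          | \<mu> p1 p2. 0 \<le> \<mu> \<and> \<mu> \<le> 1 \<and> p1 \<in> LC1 \<and> p2 \<in> LC2}"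

definition ev_prob :: "behav \<Rightarrow> (bool \<Rightarrow> bool \<Rightarrow> bool \<Rightarrow> bool \<Rightarrow> bool)
    \<Rightarrow> bool \<Rightarrow> bool \<Rightarrow> bool \<Rightarrow> bool \<Rightarrow> real" where
  "ev_prob p E x1 x2 y z =
     (\<Sum>a1\<in>UNIV. \<Sum>a2\<in>UNIV. \<Sum>b\<in>UNIV. \<Sum>c\<in>UNIV.
        if E a1 a2 b c then p a1 a2 b c x1 x2 y z else 0)"

definition score :: "behav \<Rightarrow> real" where
  "score p =
     (1/8) * (\<Sum>x1\<in>UNIV. \<Sum>x2\<in>UNIV. \<Sum>z\<in>UNIV.
        ev_prob p (\<lambda>a1 a2 b c. b = False \<and> a2 = x1) x1 x2 False z)
   + (1/8) * (\<Sum>x1\<in>UNIV. \<Sum>x2\<in>UNIV. \<Sum>z\<in>UNIV.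
        ev_prob p (\<lambda>a1 a2 b c. b = True \<and> a1 = x2) x1 x2 False z)
   + (1/4) * (\<Sum>y\<in>UNIV. \<Sum>z\<in>UNIV.
        ev_prob p (\<lambda>a1 a2 b c. (b \<noteq> c) = (y \<and> z)) False False y z)"

end

theory Submission
  imports Defs
begin

text \<open>The score is affine in the behaviour, and exchanging the two parties while flipping both b and
  c maps LC2 into LC1 without changing the score, so it suffices to treat LC1. Put
  \<beta> = p(b=0 | y=0). The first term is at most \<beta>. Since the joint law of a1 and b does
  not depend on x2, guessing a uniform x2 by a1 succeeds with probability 1/2 whatever b is, so the
  second term equals (1 - \<beta>)/2. Finally, in a no-signalling box a biased b limits the CHSH
  winning probability to 5/4 - \<beta>/2. Hence the score is at most
  (1 + \<beta>)/2 + (5/4 - \<beta>/2) = 7/4.\<close>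

definition dist_b :: "behav \<Rightarrow> bool \<Rightarrow> bool \<Rightarrow> bool \<Rightarrow> bool \<Rightarrow> bool \<Rightarrow> real" where
  "dist_b p b x1 x2 y z = (\<Sum>a1\<in>UNIV. \<Sum>a2\<in>UNIV. \<Sum>c\<in>UNIV. p a1 a2 b c x1 x2 y z)"

definition party_swap :: "behav \<Rightarrow> behav" where
  "party_swap p = (\<lambda>a1 a2 b c x1 x2 y z. p a2 a1 (\<not> b) (\<not> c) x2 x1 y z)"

lemma NS_nonneg: "p \<in> NS \<Longrightarrow> 0 \<le> p a1 a2 b c x1 x2 y z"
  by (simp add: NS_def cond_dist_def)

lemma dist_b_cong:
  "p \<in> NS \<Longrightarrow> dist_b p b x1 x2 y z = dist_b p b x1' x2' y z'"
  unfolding NS_def dist_b_def by blast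

lemma dist_b_sum:
  assumes "p \<in> NS"
  shows "dist_b p False x1 x2 y z + dist_b p True x1 x2 y z = 1"
proof -
  have "(\<Sum>a1\<in>UNIV. \<Sum>a2\<in>UNIV. \<Sum>b\<in>UNIV. \<Sum>c\<in>UNIV. p a1 a2 b c x1 x2 y z) = 1"
    using assms by (simp add: NS_def cond_dist_def)
  then show ?thesis
    by (simp add: dist_b_def UNIV_bool)
qed

text \<open>The bias of b at y = 0 is spread along the chain
  P(b=0|y=0), P(c=0|z=0), P(b=0|y=1), P(c=1|z=1), P(b=1|y=0):
  each link costs at least the difference of its two ends.\<close>

lemma chsh_biased:
  fixes q :: "bool \<Rightarrow> bool \<Rightarrow> bool \<Rightarrow> bool \<Rightarrow> real"
  assumes nn: "\<And>b c y z. 0 \<le> q b c y z"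
    and norm: "\<And>y z. (\<Sum>b\<in>UNIV. \<Sum>c\<in>UNIV. q b c y z) = 1"
    and nsb: "\<And>b y z z'. (\<Sum>c\<in>UNIV. q b c y z) = (\<Sum>c\<in>UNIV. q b c y z')"
    and nsc: "\<And>c y y' z. (\<Sum>b\<in>UNIV. q b c y z) = (\<Sum>b\<in>UNIV. q b c y' z)"
  shows "(\<Sum>y\<in>UNIV. \<Sum>z\<in>UNIV. \<Sum>b\<in>UNIV. \<Sum>c\<in>UNIV.
            if (b \<noteq> c) = (y \<and> z) then q b c y z else 0)
          \<le> 5 - 2 * (\<Sum>c\<in>UNIV. q False c False z0)"
proof -
  have S: "(\<Sum>b\<in>UNIV. f b) = f False + f True" for f :: "bool \<Rightarrow> real"
    by (simp add: UNIV_bool)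
  have z0: "(\<Sum>c\<in>UNIV. q False c False z0) = (\<Sum>c\<in>UNIV. q False c False False)"
    by (rule nsb)
  note eqs = nsb[of False False False True, unfolded S] nsb[of False True False True, unfolded S]
    nsc[of False False False True, unfolded S] nsc[of False False True True, unfolded S]
    norm[of False False, unfolded S] norm[of False True, unfolded S]
    norm[of True False, unfolded S] norm[of True True, unfolded S]
  have "q False False False False + q True True False False
      + (q False False False True + q True True False True)
      + (q False False True False + q True True True False
      + (q False True True True + q True False True True))
      \<le> 5 - 2 * (q False False False False + q False True False False)"
    \<comment> \<open>In each round the losing probability equals the drop along its link plus twice
      one of these four cells. The drops telescope to P(b=0|y=0) - P(b=1|y=0), and the four wins
      total at most 4 minus that difference.\<close>
    using eqs nn[of True False False False] nn[of True False False True]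
      nn[of False True True False] nn[of True True True True]
    by argo
  then show ?thesis
    unfolding z0 by (simp add: S)
qed

text \<open>At x1 = x2 = 0, summing out a1 and a2 leaves a bipartite box with inputs y, z and
  outputs b, c. The two conditions of \<open>NS\<close> make it no-signalling in both directions, so
  \<open>chsh_biased\<close> applies.\<close>

lemma chsh_score_le:
  assumes p: "p \<in> NS"
  shows "(\<Sum>y\<in>UNIV. \<Sum>z\<in>UNIV. ev_prob p (\<lambda>a1 a2 b c. (b \<noteq> c) = (y \<and> z)) False False y z)
          \<le> 5 - 2 * dist_b p False False False False False"
proof -
  define q where "q = (\<lambda>b c y z. \<Sum>a1\<in>UNIV. \<Sum>a2\<in>UNIV. p a1 a2 b c False False y z)"
  have nn: "0 \<le> q b c y z" for b c y z
    by (simp add: q_def sum_nonneg NS_nonneg[OF p])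
  have norm: "(\<Sum>b\<in>UNIV. \<Sum>c\<in>UNIV. q b c y z) = 1" for y z
    using dist_b_sum[OF p, of False False y z] by (simp add: q_def dist_b_def UNIV_bool)
  have nsb: "(\<Sum>c\<in>UNIV. q b c y z) = (\<Sum>c\<in>UNIV. q b c y z')" for b y z z'
    using dist_b_cong[OF p, of b False False y z False False z']
    by (simp add: q_def dist_b_def UNIV_bool)
  have nsc: "(\<Sum>b\<in>UNIV. q b c y z) = (\<Sum>b\<in>UNIV. q b c y' z)" for c y y' z
  proof -
    have "(\<Sum>b\<in>UNIV. p a1 a2 b c False False y z) = (\<Sum>b\<in>UNIV. p a1 a2 b c False False y' z)"
      for a1 a2
      using p unfolding NS_def by blast
    then have "(\<Sum>a1\<in>UNIV. \<Sum>a2\<in>UNIV. \<Sum>b\<in>UNIV. p a1 a2 b c False False y z)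
             = (\<Sum>a1\<in>UNIV. \<Sum>a2\<in>UNIV. \<Sum>b\<in>UNIV. p a1 a2 b c False False y' z)"
      by (simp only:)
    then show ?thesis
      by (simp add: q_def UNIV_bool)
  qed
  have "(\<Sum>y\<in>UNIV. \<Sum>z\<in>UNIV. ev_prob p (\<lambda>a1 a2 b c. (b \<noteq> c) = (y \<and> z)) False False y z)
      = (\<Sum>y\<in>UNIV. \<Sum>z\<in>UNIV. \<Sum>b\<in>UNIV. \<Sum>c\<in>UNIV.
            if (b \<noteq> c) = (y \<and> z) then q b c y z else 0)"
    by (simp add: ev_prob_def q_def UNIV_bool)
  also have "\<dots> \<le> 5 - 2 * (\<Sum>c\<in>UNIV. q False c False False)"
    by (rule chsh_biased[OF nn norm nsb nsc])
  also have "(\<Sum>c\<in>UNIV. q False c False False) = dist_b p False False False False False"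
    by (simp add: q_def dist_b_def UNIV_bool)
  finally show ?thesis .
qed

lemma ev_prob_b_le_dist_b:
  assumes p: "p \<in> NS"
  shows "ev_prob p (\<lambda>a1 a2 b c. b = b0 \<and> E a1 a2 c) x1 x2 y z \<le> dist_b p b0 x1 x2 y z"
proof -
  have "ev_prob p (\<lambda>a1 a2 b c. b = b0 \<and> E a1 a2 c) x1 x2 y z
      \<le> (\<Sum>a1\<in>UNIV. \<Sum>a2\<in>UNIV. \<Sum>b\<in>UNIV. \<Sum>c\<in>UNIV. if b = b0 then p a1 a2 b c x1 x2 y z else 0)"
    unfolding ev_prob_def by (intro sum_mono) (auto simp: NS_nonneg[OF p])
  also have "\<dots> = dist_b p b0 x1 x2 y z"
    by (cases b0) (simp_all add: dist_b_def UNIV_bool)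
  finally show ?thesis .
qed

text \<open>Winning takes a1 = 0 at x2 = 0 and a1 = 1 at x2 = 1. In \<open>LC1\<close> the joint law
  of a1 and b ignores x2, so the second event can also be evaluated at x2 = 0, where the two
  together exhaust b = 1.\<close>

lemma LC1_guess_x2:
  assumes p: "p \<in> LC1"
  shows "(\<Sum>x2\<in>UNIV. ev_prob p (\<lambda>a1 a2 b c. b = True \<and> a1 = x2) x1 x2 y z)
          = dist_b p True x1 False y z"
proof -
  have "(\<Sum>a2\<in>UNIV. \<Sum>c\<in>UNIV. p True a2 True c x1 True y z)
      = (\<Sum>a2\<in>UNIV. \<Sum>c\<in>UNIV. p True a2 True c x1 False y z)"
    using p unfolding LC1_def by blast
  then show ?thesis
    by (simp add: ev_prob_def dist_b_def UNIV_bool)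
qed

lemma score_le_LC1:
  assumes p: "p \<in> LC1"
  shows "score p \<le> 7/4"
proof -
  have ns: "p \<in> NS"
    using p by (simp add: LC1_def)
  define \<beta> where "\<beta> = dist_b p False False False False False"
  have b0: "dist_b p False x1 x2 False z = \<beta>" for x1 x2 z
    unfolding \<beta>_def by (rule dist_b_cong[OF ns])
  have b1: "dist_b p True x1 x2 False z = 1 - \<beta>" for x1 x2 z
    using dist_b_sum[OF ns, of x1 x2 False z] by (simp add: b0)
  \<comment> \<open>In \<open>LC1\<close> a2 may copy x1, so the guess can be perfect and only the
    factor b = 0 limits this term.\<close>
  have "(\<Sum>x1\<in>UNIV. \<Sum>x2\<in>UNIV. \<Sum>z\<in>UNIV.
          ev_prob p (\<lambda>a1 a2 b c. b = False \<and> a2 = x1) x1 x2 False z)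
      \<le> (\<Sum>x1\<in>(UNIV::bool set). \<Sum>x2\<in>(UNIV::bool set). \<Sum>z\<in>(UNIV::bool set). \<beta>)"
    by (intro sum_mono order_trans[OF ev_prob_b_le_dist_b[OF ns]]) (simp add: b0)
  then have t1: "(\<Sum>x1\<in>UNIV. \<Sum>x2\<in>UNIV. \<Sum>z\<in>UNIV.
          ev_prob p (\<lambda>a1 a2 b c. b = False \<and> a2 = x1) x1 x2 False z) \<le> 8 * \<beta>"
    by simp
  \<comment> \<open>Moving x2 innermost lets \<open>LC1_guess_x2\<close> collapse that sum; each of
    the four pairs x1, z then contributes 1 - \<beta>.\<close>
  have "(\<Sum>x1\<in>UNIV. \<Sum>x2\<in>UNIV. \<Sum>z\<in>UNIV.
          ev_prob p (\<lambda>a1 a2 b c. b = True \<and> a1 = x2) x1 x2 False z)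
      = (\<Sum>x1\<in>UNIV. \<Sum>z\<in>UNIV. \<Sum>x2\<in>UNIV.
          ev_prob p (\<lambda>a1 a2 b c. b = True \<and> a1 = x2) x1 x2 False z)"
    by (rule sum.cong[OF refl sum.swap])
  also have "\<dots> = 4 * (1 - \<beta>)"
    unfolding LC1_guess_x2[OF p] b1 by simp
  finally have t2: "(\<Sum>x1\<in>UNIV. \<Sum>x2\<in>UNIV. \<Sum>z\<in>UNIV.
          ev_prob p (\<lambda>a1 a2 b c. b = True \<and> a1 = x2) x1 x2 False z) = 4 * (1 - \<beta>)" .
  have t3: "(\<Sum>y\<in>UNIV. \<Sum>z\<in>UNIV.
          ev_prob p (\<lambda>a1 a2 b c. (b \<noteq> c) = (y \<and> z)) False False y z) \<le> 5 - 2 * \<beta>"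
    unfolding \<beta>_def by (rule chsh_score_le[OF ns])
  \<comment> \<open>With weights 1/8, 1/8 and 1/4 the three bounds add up to 7/4, as \<beta>
    cancels.\<close>
  show ?thesis
    unfolding score_def using t1 t2 t3 by argo
qed

text \<open>Swapping the parties and flipping b exchanges the first two terms. Flipping c as well
  preserves the parity of b and c, and the condition x1 = x2 = 0 is symmetric, so the third term is
  unchanged.\<close>

lemma score_party_swap: "score (party_swap p) = score p"
  by (simp add: score_def ev_prob_def party_swap_def UNIV_bool add_ac)

lemma sum_bool_Not: "(\<Sum>b\<in>UNIV. f (\<not> b)) = (\<Sum>b\<in>UNIV. f b :: real)"
  by (simp add: UNIV_bool)

lemma cond_dist_party_swap:
  assumes "cond_dist p"
  shows "cond_dist (party_swap p)"
proof -
  have "(\<Sum>a1\<in>UNIV. \<Sum>a2\<in>UNIV. \<Sum>b\<in>UNIV. \<Sum>c\<in>UNIV. party_swap p a1 a2 b c x1 x2 y z)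
      = (\<Sum>a1\<in>UNIV. \<Sum>a2\<in>UNIV. \<Sum>b\<in>UNIV. \<Sum>c\<in>UNIV. p a1 a2 b c x2 x1 y z)" for x1 x2 y z
    by (simp add: party_swap_def UNIV_bool)
  with assms show ?thesis
    by (simp add: cond_dist_def party_swap_def)
qed

lemma NS_party_swap:
  assumes p: "p \<in> NS"
  shows "party_swap p \<in> NS"
proof -
  have b: "(\<Sum>b\<in>UNIV. party_swap p a1 a2 b c x1 x2 y z) = (\<Sum>b\<in>UNIV. p a2 a1 b (\<not> c) x2 x1 y z)"
    for a1 a2 c x1 x2 y z
    unfolding party_swap_def by (rule sum_bool_Not)
  have d: "(\<Sum>a1\<in>UNIV. \<Sum>a2\<in>UNIV. \<Sum>c\<in>UNIV. party_swap p a1 a2 b c x1 x2 y z)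
      = dist_b p (\<not> b) x2 x1 y z" for b x1 x2 y z
    by (simp add: party_swap_def dist_b_def UNIV_bool)
  show ?thesis
    unfolding NS_def mem_Collect_eq b d
  proof (intro conjI allI)
    show "cond_dist (party_swap p)"
      using p by (simp add: NS_def cond_dist_party_swap)
    show "(\<Sum>b\<in>UNIV. p a2 a1 b (\<not> c) x2 x1 y z) = (\<Sum>b\<in>UNIV. p a2 a1 b (\<not> c) x2 x1 y' z)"
      for a1 a2 c x1 x2 y y' z
      using p unfolding NS_def by blast
    show "dist_b p (\<not> b) x2 x1 y z = dist_b p (\<not> b) x2' x1' y z'" for b y x1 x2 z x1' x2' z'
      by (rule dist_b_cong[OF p])
  qed
qed

text \<open>The swap turns independence of a2, b from x1 into independence of a1, b from x2. The
  flip of b merely relabels an outcome, and that of c is absorbed by the sum over c.\<close>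

lemma LC1_party_swap:
  assumes p: "p \<in> LC2"
  shows "party_swap p \<in> LC1"
proof -
  have ac: "(\<Sum>a2\<in>UNIV. \<Sum>c\<in>UNIV. party_swap p a1 a2 b c x1 x2 y z)
      = (\<Sum>a1'\<in>UNIV. \<Sum>c\<in>UNIV. p a1' a1 (\<not> b) c x2 x1 y z)" for a1 b x1 x2 y z
    by (simp add: party_swap_def UNIV_bool)
  have c: "(\<Sum>c\<in>UNIV. party_swap p a1 a2 b c x1 x2 y z) = (\<Sum>c\<in>UNIV. p a2 a1 (\<not> b) c x2 x1 y z)"
    for a1 a2 b x1 x2 y z
    unfolding party_swap_def by (rule sum_bool_Not)
  show ?thesis
    unfolding LC1_def ind_a1a2b_z_def mem_Collect_eq ac c
    using p NS_party_swap unfolding LC2_def ind_a1a2b_z_def by blast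
qed

lemma ev_prob_mix:
  "ev_prob (\<lambda>a1 a2 b c x1 x2 y z. s * p a1 a2 b c x1 x2 y z + t * q a1 a2 b c x1 x2 y z) E x1 x2 y z
    = s * ev_prob p E x1 x2 y z + t * ev_prob q E x1 x2 y z"
  unfolding ev_prob_def sum_distrib_left sum.distrib[symmetric]
  by (intro sum.cong refl) simp

lemma score_mix:
  "score (\<lambda>a1 a2 b c x1 x2 y z. s * p a1 a2 b c x1 x2 y z + t * q a1 a2 b c x1 x2 y z)
    = s * score p + t * score q"
  unfolding score_def ev_prob_mix sum.distrib sum_distrib_left[symmetric]
  by (simp add: algebra_simps)

lemma score_le_LC:
  assumes "p \<in> LC"
  shows "score p \<le> 7/4"
proof -
  obtain \<mu> p1 p2 where \<mu>: "0 \<le> \<mu>" "\<mu> \<le> 1" and p1: "p1 \<in> LC1" and p2: "p2 \<in> LC2"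
    and p: "p = (\<lambda>a1 a2 b c x1 x2 y z. \<mu> * p1 a1 a2 b c x1 x2 y z + (1 - \<mu>) * p2 a1 a2 b c x1 x2 y z)"
    using assms unfolding LC_def by blast
  have "score p2 \<le> 7/4"
    using score_le_LC1[OF LC1_party_swap[OF p2]] by (simp only: score_party_swap)
  then have "\<mu> * score p1 + (1 - \<mu>) * score p2 \<le> 7/4"
    using \<mu> score_le_LC1[OF p1] by (intro convex_bound_le) simp_all
  then show ?thesis
    unfolding p score_mix .
qed

text \<open>The outcomes are a2 = x1 and all others 0, so only the CHSH round y = z = 1 is lost.\<close>

definition copy_x1 :: behav where
  "copy_x1 = (\<lambda>a1 a2 b c x1 x2 y z. of_bool (\<not> a1 \<and> a2 = x1 \<and> \<not> b \<and> \<not> c))"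

text \<open>A filler: viewing a member of \<open>LC1\<close> as a mixture with weight 1 still calls
  for some member of \<open>LC2\<close>.\<close>

definition all_zero :: behav where
  "all_zero = (\<lambda>a1 a2 b c x1 x2 y z. of_bool (\<not> a1 \<and> \<not> a2 \<and> \<not> b \<and> \<not> c))"

lemma copy_x1_in_LC1: "copy_x1 \<in> LC1"
  by (simp add: LC1_def NS_def cond_dist_def ind_a1a2b_z_def copy_x1_def UNIV_bool all_bool_eq)

lemma all_zero_in_LC2: "all_zero \<in> LC2"
  by (simp add: LC2_def NS_def cond_dist_def ind_a1a2b_z_def all_zero_def UNIV_bool)

lemma LC1_subset_LC: "LC1 \<subseteq> LC"
proof
  fix p assume "p \<in> LC1"
  then show "p \<in> LC"
    unfolding LC_def mem_Collect_eq
    by (intro exI[of _ 1] exI[of _ p] exI[of _ all_zero]) (simp add: all_zero_in_LC2)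
qed

text \<open>The three terms are 1, 0 (b is never 1) and 3/4.\<close>

lemma score_copy_x1: "score copy_x1 = 7/4"
  by (simp add: score_def ev_prob_def copy_x1_def UNIV_bool)

theorem theorem1:
  shows "(\<forall>p\<in>LC. score p \<le> 7/4) \<and> (\<exists>p\<in>LC. score p = 7/4)"
  using score_le_LC score_copy_x1 copy_x1_in_LC1 LC1_subset_LC by blast

end
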